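(* Let $a>0$, let $q\in L^1[0,a]$ be real-valued and $m\ge0$. Let $Q(x)=\int_0^xq$ $(x\in[0,a])$ and let $\mu\in\mathbb R$, $\alpha>0$. Let $\Phi(\cdot,\lambda)$ be the $2\times 2$ matrix solution on $[0,a]$ of the initial value problem $$-i\sigma_2\Phi'(x,\lambda)+(m\sigma_3+q(x))\,\Phi(x,\lambda)=\lambda\,\Phi(x,\lambda),\qquad\Phi(0,\lambda)=\mathbb I.$$ Then, for each $x\in[0,a]$, the solution with $\lambda=\mu+i\alpha$ has the asymptotic, for $\alpha\to\infty$, $$e^{-\alpha x}\,\Phi(x,\mu+i\alpha)=\frac12\left(e^{i(Q(x)-\mu x)}+e^{-2\alpha x}e^{-i(Q(x)-\mu x)}\right)\mathbb I+\frac12\left(-e^{i(Q(x)-\mu x)}+e^{-2\alpha x}e^{-i(Q(x)-\mu x)}\right)\sigma_2+O_{\rm unif}\left(\tfrac1\alpha\right),$$ where $O_{\rm unif}$ means that the bound is uniform in $x\in[0,a]$.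
   Context: Pauli matrices: $\sigma_2=\begin{pmatrix}0&-i\\i&0\end{pmatrix}$, $\sigma_3=\begin{pmatrix}1&0\\0&-1\end{pmatrix}$; $\mathbb I$ is the $2\times2$ unit matrix. Solutions are understood to be (entrywise) absolutely continuous functions satisfying the differential equation almost everywhere. *)

theory Defs
  imports "HOL-Analysis.Analysis"
begin

text \<open>
  Absolute continuity in the usual epsilon-delta sense. A division \<open>D\<close> of \<open>\<Union>D\<close> is precisely a
  finite family of nonempty compact intervals \<open>K = {Inf K..Sup K}\<close> with pairwise disjoint
  interiors.
\<close>

definition absolutely_continuous_on :: "real set \<Rightarrow> (real \<Rightarrow> 'a::real_normed_vector) \<Rightarrow> bool" where
  "absolutely_continuous_on S f \<longleftrightarrow>
     (\<forall>\<epsilon>>0. \<exists>\<delta>>0. \<forall>D. D division_of \<Union>D \<and> \<Union>D \<subseteq> S \<and> (\<Sum>K\<in>D. Sup K - Inf K) < \<delta> \<longrightarrow>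
        (\<Sum>K\<in>D. norm (f (Sup K) - f (Inf K))) < \<epsilon>)"

definition sigma2 :: "complex^2^2" where
  "sigma2 = vector [vector [0, -\<i>], vector [\<i>, 0]]"

definition sigma3 :: "complex^2^2" where
  "sigma3 = vector [vector [1, 0], vector [0, -1]]"

text \<open>
  Complex scalar multiple of a matrix: the library operation \<open>*s\<close> would need the scalar to have
  the type of the rows, and \<open>*\<^sub>R\<close> only takes real scalars.
\<close>

definition cscale :: "complex \<Rightarrow> complex^'n^'m \<Rightarrow> complex^'n^'m" (infixr "*\<^sub>C" 75) where
  "c *\<^sub>C A = (\<chi> i j. c * A $ i $ j)"

definition dirac_matrix_solution ::
    "real \<Rightarrow> real \<Rightarrow> (real \<Rightarrow> real) \<Rightarrow> complex \<Rightarrow> (real \<Rightarrow> complex^2^2) \<Rightarrow> bool" where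
  "dirac_matrix_solution a m q lam \<Phi> \<longleftrightarrow>
     (\<forall>i j. absolutely_continuous_on {0..a} (\<lambda>x. \<Phi> x $ i $ j)) \<and>
     (AE x\<in>{0..a} in lebesgue. \<exists>\<Phi>'. (\<Phi> has_vector_derivative \<Phi>') (at x within {0..a}) \<and>
        (- \<i> *\<^sub>C sigma2) ** \<Phi>' + (m *\<^sub>R sigma3 + q x *\<^sub>R mat 1) ** \<Phi> x = lam *\<^sub>C \<Phi> x) \<and>
     \<Phi> 0 = mat 1"

end

theory Submission
  imports Defs
begin

text \<open>
  For a column \<open>(u, v)\<close> of \<open>\<Phi>\<close> put \<open>R = u + \<i> v\<close>, \<open>P = u - \<i> v\<close>, \<open>\<theta> = Q - \<mu> x\<close> and
  \<open>k = \<alpha> x + \<i> \<theta>\<close>. The system becomes \<open>R' = k' R + \<i> m P\<close>, \<open>P' = - k' P - \<i> m R\<close>, so the amplitudes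
  \<open>r = exp (- k) R\<close> and \<open>p = exp k P\<close> satisfy \<open>r' = \<i> m exp (- 2 k) p\<close> and
  \<open>p' = - \<i> m exp (2 k) r\<close>. As \<open>\<bar>exp k\<bar> = exp (\<alpha> x)\<close> does not involve \<open>q\<close>, integrating these two
  equations gives bounds that are uniform in \<open>x\<close> and need no regularity of \<open>q\<close>.
\<close>

subsection \<open>Absolutely continuous functions\<close>

text \<open>The rows \<open>(1, \<i>)\<close> and \<open>(1, - \<i>)\<close> are left eigenvectors
  of \<open>sigma2\<close> for the eigenvalues \<open>- 1\<close> and \<open>1\<close>, and
  \<open>sigma3\<close> interchanges them. This is the origin of \<open>R\<close> and
  \<open>P\<close> and the reason why only the mass term couples them. In terms of amplitudes,
  \<open>r\<close> stays within a multiple of \<open>1 / \<alpha>\<close> of \<open>r 0\<close>,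
  whereas \<open>p - p 0\<close> may grow like \<open>exp (2 * \<alpha> * x) / \<alpha>\<close>; it
  enters the result only after multiplication by \<open>exp (- 2 * \<alpha> * x)\<close>. The term
  with \<open>exp (- 2 * \<alpha> * x)\<close> in the asymptotics cannot be put into the error,
  because it is not small uniformly near \<open>x = 0\<close>. The factor
  \<open>1 / (2 * \<alpha>)\<close> comes from integrating \<open>exp (2 * \<alpha> * t)\<close> or
  \<open>exp (- 2 * \<alpha> * t)\<close>. The obstacle is that \<open>q\<close> is merely
  integrable: the differential equations hold off a null set only. Passing to integrals therefore
  needs the fundamental theorem of calculus for absolutely continuous functions, and the phase
  \<open>k\<close> needs the integral of \<open>q\<close> to be absolutely continuous with
  derivative \<open>q\<close> almost everywhere.\<close>

lemma absolutely_continuous_on_subset: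
  assumes "absolutely_continuous_on S f" "T \<subseteq> S"
  shows "absolutely_continuous_on T f"
proof -
  have "D division_of \<Union>D \<and> \<Union>D \<subseteq> T \<and> P D \<Longrightarrow> D division_of \<Union>D \<and> \<Union>D \<subseteq> S \<and> P D" for D P
    using order_trans[OF _ assms(2)] by simp
  then show ?thesis
    using assms(1) unfolding absolutely_continuous_on_def by meson
qed

lemma division_of_endpoints:
  fixes D :: "real set set"
  assumes "D division_of \<Union>D" "K \<in> D"
  shows "Inf K \<le> Sup K" "Inf K \<in> \<Union>D" "Sup K \<in> \<Union>D" "K = {Inf K..Sup K}"
proof -
  obtain u v where K: "K = cbox u v" "K \<noteq> {}"
    using division_ofD(3,4)[OF assms] by blast
  then have "u \<le> v" by auto
  with K have "Inf K = u" "Sup K = v" by auto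
  with \<open>u \<le> v\<close> K(1) show "Inf K \<le> Sup K" and eq: "K = {Inf K..Sup K}"
    by simp_all
  then have "Inf K \<in> K" "Sup K \<in> K"
    by (metis atLeastAtMost_iff order_refl)+
  with assms(2) show "Inf K \<in> \<Union>D" "Sup K \<in> \<Union>D"
    by blast+
qed

text \<open>A common closure principle: products, exponentials, the phase \<open>k\<close> and the
  combinations \<open>R\<close> and \<open>P\<close> are all handled by estimating increments. A
  function dominated by a single one is the case \<open>B = 0\<close>.\<close>

lemma absolutely_continuous_on_dominated:
  fixes f :: "real \<Rightarrow> 'a::real_normed_vector" and g :: "real \<Rightarrow> 'b::real_normed_vector"
    and h :: "real \<Rightarrow> 'c::real_normed_vector"
  assumes f: "absolutely_continuous_on S f" and g: "absolutely_continuous_on S g"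
    and le: "\<And>u v. u \<in> S \<Longrightarrow> v \<in> S \<Longrightarrow>
               norm (h v - h u) \<le> A * norm (f v - f u) + B * norm (g v - g u)"
  shows "absolutely_continuous_on S h"
  unfolding absolutely_continuous_on_def
proof (intro allI impI)
  fix e :: real
  assume "e > 0"
  \<comment> \<open>The signs of \<open>A\<close> and \<open>B\<close> are arbitrary, so both are
    replaced by one majorant; the summand 1 makes it positive, hence a legitimate divisor of
    \<open>e\<close>.\<close>
  define C where "C = \<bar>A\<bar> + \<bar>B\<bar> + 1"
  have C: "C > 0" "\<bar>A\<bar> \<le> C" "\<bar>B\<bar> \<le> C" by (auto simp: C_def)
  then have e': "e / (2 * C) > 0" using \<open>e > 0\<close> by simp
  obtain d1 where d1: "d1 > 0" "\<And>D. D division_of \<Union>D \<Longrightarrow> \<Union>D \<subseteq> S \<Longrightarrow>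
      (\<Sum>K\<in>D. Sup K - Inf K) < d1 \<Longrightarrow> (\<Sum>K\<in>D. norm (f (Sup K) - f (Inf K))) < e / (2 * C)"
    using f e' unfolding absolutely_continuous_on_def by meson
  obtain d2 where d2: "d2 > 0" "\<And>D. D division_of \<Union>D \<Longrightarrow> \<Union>D \<subseteq> S \<Longrightarrow>
      (\<Sum>K\<in>D. Sup K - Inf K) < d2 \<Longrightarrow> (\<Sum>K\<in>D. norm (g (Sup K) - g (Inf K))) < e / (2 * C)"
    using g e' unfolding absolutely_continuous_on_def by meson
  show "\<exists>d>0. \<forall>D. D division_of \<Union>D \<and> \<Union>D \<subseteq> S \<and> (\<Sum>K\<in>D. Sup K - Inf K) < d \<longrightarrow>
          (\<Sum>K\<in>D. norm (h (Sup K) - h (Inf K))) < e"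
  proof (intro exI[of _ "min d1 d2"] conjI allI impI; (elim conjE)?)
    fix D :: "real set set"
    assume D: "D division_of \<Union>D" "\<Union>D \<subseteq> S" "(\<Sum>K\<in>D. Sup K - Inf K) < min d1 d2"
    have "(\<Sum>K\<in>D. norm (h (Sup K) - h (Inf K)))
        \<le> (\<Sum>K\<in>D. C * norm (f (Sup K) - f (Inf K)) + C * norm (g (Sup K) - g (Inf K)))"
    proof (rule sum_mono)
      fix K assume "K \<in> D"
      then have "Inf K \<in> S" "Sup K \<in> S"
        using division_of_endpoints[OF D(1)] D(2) by blast+
      then have "norm (h (Sup K) - h (Inf K))
          \<le> A * norm (f (Sup K) - f (Inf K)) + B * norm (g (Sup K) - g (Inf K))"
        by (rule le)
      also have "\<dots> \<le> C * norm (f (Sup K) - f (Inf K)) + C * norm (g (Sup K) - g (Inf K))"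
        using C by (intro add_mono mult_right_mono) auto
      finally show "norm (h (Sup K) - h (Inf K)) \<le> \<dots>" .
    qed
    also have "\<dots> = C * ((\<Sum>K\<in>D. norm (f (Sup K) - f (Inf K))) + (\<Sum>K\<in>D. norm (g (Sup K) - g (Inf K))))"
      by (simp add: sum.distrib sum_distrib_left distrib_left)
    also have "\<dots> < C * (e / (2 * C) + e / (2 * C))"
      using D by (intro mult_strict_left_mono add_strict_mono d1 d2 C) auto
    also have "\<dots> = e" using C by (simp add: field_simps)
    finally show "(\<Sum>K\<in>D. norm (h (Sup K) - h (Inf K))) < e" .
  qed (use d1(1) d2(1) in simp)
qed

lemma absolutely_continuous_on_ident: "absolutely_continuous_on S (\<lambda>x. x)"
  unfolding absolutely_continuous_on_def
proof (intro allI impI exI conjI; (elim conjE)?)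
  fix e :: real and D :: "real set set"
  assume D: "D division_of \<Union>D" "(\<Sum>K\<in>D. Sup K - Inf K) < e"
  have "(\<Sum>K\<in>D. norm (Sup K - Inf K)) = (\<Sum>K\<in>D. Sup K - Inf K)"
    using division_of_endpoints(1)[OF D(1)] by (intro sum.cong) auto
  with D show "(\<Sum>K\<in>D. norm (Sup K - Inf K)) < e" by simp
qed

lemma absolutely_continuous_on_imp_continuous_on:
  assumes "absolutely_continuous_on {a..b} f"
  shows "continuous_on {a..b} f"
  unfolding continuous_on_iff
proof (intro ballI allI impI)
  fix x e :: real
  assume x: "x \<in> {a..b}" and "e > 0"
  then obtain d where d: "d > 0" "\<And>D. D division_of \<Union>D \<Longrightarrow> \<Union>D \<subseteq> {a..b} \<Longrightarrow>
      (\<Sum>K\<in>D. Sup K - Inf K) < d \<Longrightarrow> (\<Sum>K\<in>D. norm (f (Sup K) - f (Inf K))) < e"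
    using assms unfolding absolutely_continuous_on_def by meson
  have *: "dist (f v) (f u) < e" if "u \<in> {a..b}" "v \<in> {a..b}" "u \<le> v" "v - u < d" for u v
  proof -
    have "{{u..v}} division_of \<Union>{{u..v}}"
      using that division_of_self[of u v] by simp
    then show ?thesis
      using d(2)[of "{{u..v}}"] that by (simp add: dist_norm)
  qed
  show "\<exists>d>0. \<forall>x'\<in>{a..b}. dist x' x < d \<longrightarrow> dist (f x') (f x) < e"
  proof (intro exI[of _ d] conjI ballI impI d)
    fix y assume "y \<in> {a..b}" "dist y x < d"
    then show "dist (f y) (f x) < e"
      using *[of x y] *[of y x] x by (simp add: dist_commute dist_real_def abs_if split: if_splits)
  qed
qed

lemma absolutely_continuous_on_imp_bounded:
  "absolutely_continuous_on {a..b} f \<Longrightarrow> bounded (f ` {a..b})"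
  by (rule compact_imp_bounded, rule compact_continuous_image,
      erule absolutely_continuous_on_imp_continuous_on, rule compact_Icc)

lemma absolutely_continuous_on_mult:
  fixes f g :: "real \<Rightarrow> 'a::real_normed_algebra"
  assumes f: "absolutely_continuous_on {a..b} f" and g: "absolutely_continuous_on {a..b} g"
  shows "absolutely_continuous_on {a..b} (\<lambda>x. f x * g x)"
proof -
  obtain F where F: "\<And>x. x \<in> {a..b} \<Longrightarrow> norm (f x) \<le> F"
    using absolutely_continuous_on_imp_bounded[OF f] by (force simp: bounded_iff)
  obtain G where G: "\<And>x. x \<in> {a..b} \<Longrightarrow> norm (g x) \<le> G"
    using absolutely_continuous_on_imp_bounded[OF g] by (force simp: bounded_iff)
  show ?thesis
  proof (rule absolutely_continuous_on_dominated[OF f g])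
    fix u v assume uv: "u \<in> {a..b}" "v \<in> {a..b}"
    have "f v * g v - f u * g u = (f v - f u) * g v + f u * (g v - g u)"
      by (simp add: algebra_simps)
    then have "norm (f v * g v - f u * g u)
        \<le> norm (f v - f u) * norm (g v) + norm (f u) * norm (g v - g u)"
      by (simp only:) (rule norm_triangle_le, rule add_mono; rule norm_mult_ineq)
    also have "\<dots> \<le> norm (f v - f u) * G + F * norm (g v - g u)"
      using F G uv by (intro add_mono mult_left_mono mult_right_mono) auto
    finally show "norm (f v * g v - f u * g u) \<le> G * norm (f v - f u) + F * norm (g v - g u)"
      by (simp add: mult.commute)
  qed
qed

text \<open>The values of \<open>f\<close> lie in a ball of some radius \<open>F\<close>. The ball
  is convex and the derivative of \<open>exp\<close> is bounded there by \<open>exp F\<close>, so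
  \<open>exp\<close> is Lipschitz on it.\<close>

lemma absolutely_continuous_on_exp:
  fixes f :: "real \<Rightarrow> complex"
  assumes f: "absolutely_continuous_on {a..b} f"
  shows "absolutely_continuous_on {a..b} (\<lambda>x. exp (f x))"
proof -
  obtain F where F: "\<And>x. x \<in> {a..b} \<Longrightarrow> norm (f x) \<le> F"
    using absolutely_continuous_on_imp_bounded[OF f] by (force simp: bounded_iff)
  show ?thesis
  proof (rule absolutely_continuous_on_dominated[OF f f, where A = "exp F" and B = 0])
    fix u v assume uv: "u \<in> {a..b}" "v \<in> {a..b}"
    have "norm (exp (f v) - exp (f u)) \<le> exp F * norm (f v - f u)"
    proof (rule field_differentiable_bound[of "cball 0 F"])
      show "(exp has_field_derivative exp z) (at z within cball 0 F)" for z :: complex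
        by (auto intro!: derivative_eq_intros)
      show "norm (exp z) \<le> exp F" if "z \<in> cball 0 F" for z :: complex
        using that complex_Re_le_cmod[of z] by auto
    qed (use F uv in auto)
    then show "norm (exp (f v) - exp (f u)) \<le> exp F * norm (f v - f u) + 0 * norm (f v - f u)"
      by simp
  qed
qed

section \<open>The fundamental theorem of calculus for absolutely continuous functions\<close>

lemma division_length_le_measure:
  fixes D :: "real set set"
  assumes "D division_of \<Union>D" "\<Union>D \<subseteq> U" "U \<in> lmeasurable"
  shows "(\<Sum>K\<in>D. Sup K - Inf K) \<le> measure lebesgue U"
proof -
  have "(\<Sum>K\<in>D. Sup K - Inf K) = (\<Sum>K\<in>D. integral K (\<lambda>x. 1))"
  proof (rule sum.cong)
    fix K assume "K \<in> D"
    then show "Sup K - Inf K = integral K (\<lambda>x. 1)"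
      using division_of_endpoints(1,4)[OF assms(1)]
      by (metis content_real integral_const_real mult.right_neutral real_scaleR_def)
  qed simp
  also have "\<dots> = integral (\<Union>D) (\<lambda>x. 1)"
    using integral_combine_division_bottomup[OF assms(1), of "\<lambda>x. 1 :: real"]
      division_ofD(4)[OF assms(1)] by (metis integrable_const)
  also have "\<dots> \<le> integral U (\<lambda>x. 1)"
  proof (rule integral_subset_le)
    have "compact K" if "K \<in> D" for K
      using division_ofD(4)[OF assms(1) that] by auto
    then have "compact (\<Union>D)"
      using division_of_finite[OF assms(1)] by (rule compact_Union[rotated])
    then show "(\<lambda>x. 1::real) integrable_on \<Union>D"
      by (intro integrable_on_const lmeasurable_compact)
  qed (use assms in \<open>auto intro: integrable_on_const\<close>)
  also have "\<dots> = measure lebesgue U"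
    using assms(3) by (simp add: lmeasure_integral)
  finally show ?thesis .
qed

text \<open>The gauge definition of the integral lets the tags be treated separately. At a tag
  outside \<open>N\<close> the gauge is fine enough for differentiability to control the increment
  of \<open>f\<close>. At a tag in \<open>N\<close> the integrand is set to 0 and the gauge confines
  the interval to an open set \<open>U\<close> of small measure containing \<open>N\<close>;
  absolute continuity then makes the total increment over these intervals small.\<close>

theorem fundamental_theorem_of_calculus_absolutely_continuous:
  fixes f :: "real \<Rightarrow> 'a::banach"
  assumes "a \<le> b" and ac: "absolutely_continuous_on {a..b} f" and N: "negligible N"
    and der: "\<And>x. x \<in> {a..b} - N \<Longrightarrow> (f has_vector_derivative f' x) (at x within {a..b})"
  shows "(f' has_integral (f b - f a)) {a..b}"
proof -
  define g where "g x = (if x \<in> N then 0 else f' x)" for x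
  have "(g has_integral (f b - f a)) (cbox a b)"
    unfolding has_integral
  proof (intro allI impI)
    fix e :: real
    assume "e > 0"
    \<comment> \<open>The summand 1 covers the case \<open>a = b\<close> and gives a strict
      inequality in \<open>\<epsilon> * (b - a) < e / 2\<close>; the other half of \<open>e\<close>
      is reserved for the tags in \<open>N\<close>.\<close>
    define \<epsilon> where "\<epsilon> = e / (2 * (b - a + 1))"
    have \<epsilon>: "\<epsilon> > 0" "\<epsilon> * (b - a) < e / 2"
      using \<open>e > 0\<close> \<open>a \<le> b\<close> by (auto simp: \<epsilon>_def field_simps)
    have "\<forall>x. \<exists>d>0. x \<in> {a..b} - N \<longrightarrow>
         (\<forall>y\<in>{a..b}. norm (y-x) < d \<longrightarrow> norm (f y - f x - (y-x) *\<^sub>R f' x) \<le> \<epsilon> * norm (y-x))"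
      using der[unfolded has_vector_derivative_def has_derivative_within_alt] \<epsilon>
      by (meson zero_less_one)
    then obtain d where dpos: "\<And>x. 0 < d x"
      and d: "\<And>x y. \<lbrakk>x \<in> {a..b} - N; y \<in> {a..b}; norm (y-x) < d x\<rbrakk>
                    \<Longrightarrow> norm (f y - f x - (y-x) *\<^sub>R f' x) \<le> \<epsilon> * norm (y-x)"
      by metis
    obtain \<delta> where "\<delta> > 0" and \<delta>: "\<And>D. D division_of \<Union>D \<Longrightarrow> \<Union>D \<subseteq> {a..b} \<Longrightarrow>
      (\<Sum>K\<in>D. Sup K - Inf K) < \<delta> \<Longrightarrow> (\<Sum>K\<in>D. norm (f (Sup K) - f (Inf K))) < e / 2"
      using ac \<open>e > 0\<close> unfolding absolutely_continuous_on_def by (meson half_gt_zero)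
    obtain U where U: "open U" "N \<subseteq> U" "U \<in> lmeasurable" "measure lebesgue U < \<delta>"
    proof -
      obtain U where U: "open U" "N \<subseteq> U" "U - N \<in> lmeasurable" "emeasure lebesgue (U - N) < ennreal \<delta>"
        using sets_lebesgue_outer_open[OF negligible_imp_sets[OF N] \<open>\<delta> > 0\<close>] by blast
      have "U = (U - N) \<union> N" using U by blast
      moreover have "measure lebesgue (U - N) < \<delta>"
        using U \<open>\<delta> > 0\<close> by (metis emeasure_eq_measure2 ennreal_less_iff measure_nonneg)
      ultimately show ?thesis
        using that[of U] U N
        by (metis fmeasurable.Un measure_Un_null_set negligible_iff_null_sets negligible_imp_measurable fmeasurableD)
    qed
    define \<gamma> where "\<gamma> x = (if x \<in> N then U else ball x (d x))" for x
    show "\<exists>\<gamma>. gauge \<gamma> \<and> (\<forall>p. p tagged_division_of cbox a b \<and> \<gamma> fine p \<longrightarrow>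
        norm ((\<Sum>(x, K)\<in>p. measure lborel K *\<^sub>R g x) - (f b - f a)) < e)"
    proof (intro exI[of _ \<gamma>] conjI allI impI; (elim conjE)?)
      show "gauge \<gamma>"
        using U(1) subsetD[OF U(2)] dpos by (simp add: gauge_def \<gamma>_def)
    next
      fix p assume p: "p tagged_division_of cbox a b" "\<gamma> fine p"
      have fine: "K \<subseteq> \<gamma> x" if "(x, K) \<in> p" for x K
        using p(2) that by (auto simp: fine_def)
      have fin: "finite p" using p(1) by (rule tagged_division_of_finite)
      \<comment> \<open>Passing from a sum over tagged intervals to a sum over intervals requires a
        summand that vanishes on degenerate boxes. For a single point this is automatic; for the
        empty set \<open>Sup\<close> and \<open>Inf\<close> carry no information, so 0 is
        prescribed.\<close>
      define F where "F K = (if K = {} then 0 else norm (f (Sup K) - f (Inf K)))" for K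
      define p1 where "p1 = {(x, K)\<in>p. x \<in> N}"
      have ba: "b - a = (\<Sum>(x,K)\<in>p. Sup K - Inf K)" "f b - f a = (\<Sum>(x,K)\<in>p. f(Sup K) - f(Inf K))"
        using additive_tagged_division_1[where f= "\<lambda>x. x"] additive_tagged_division_1[where f= f]
          \<open>a \<le> b\<close> p(1) by auto
      have K: "\<exists>u v. K = {u..v} \<and> u \<le> v \<and> a \<le> u \<and> v \<le> b \<and> x \<in> {u..v} \<and> Sup K = v \<and> Inf K = u"
        if xK: "(x, K) \<in> p" for x K
      proof -
        obtain u v where uv: "K = {u..v}"
          using tagged_division_ofD(4)[OF p(1) xK] by auto
        have "x \<in> {u..v}" "{u..v} \<subseteq> {a..b}"
          using tagged_division_ofD(2,3)[OF p(1) xK] uv by auto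
        moreover from this have "u \<le> v" by auto
        ultimately show ?thesis using uv by (intro exI[of _ u] exI[of _ v]) simp
      qed
      have "norm ((\<Sum>(x, K)\<in>p. measure lborel K *\<^sub>R g x) - (f b - f a))
          = norm (\<Sum>(x, K)\<in>p. measure lborel K *\<^sub>R g x - (f (Sup K) - f (Inf K)))"
        unfolding ba by (simp add: split_def sum_subtractf)
      also have "\<dots> \<le> (\<Sum>(x, K)\<in>p. \<epsilon> * (Sup K - Inf K) + (if x \<in> N then F K else 0))"
      proof (rule sum_norm_le, safe)
        fix x K assume xK: "(x, K) \<in> p"
        then obtain u v where uv: "K = {u..v}" "u \<le> v" "a \<le> u" "v \<le> b" "x \<in> {u..v}"
          "Sup K = v" "Inf K = u"
          using K by blast
        show "norm (measure lborel K *\<^sub>R g x - (f (Sup K) - f (Inf K)))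
                \<le> \<epsilon> * (Sup K - Inf K) + (if x \<in> N then F K else 0)"
        proof (cases "x \<in> N")
          case True
          then show ?thesis using uv \<epsilon> by (auto simp: g_def F_def norm_minus_commute)
        next
          case False
          then have "K \<subseteq> ball x (d x)"
            using fine[OF xK] by (simp add: \<gamma>_def)
          moreover have "u \<in> K" "v \<in> K" using uv by simp_all
          ultimately have "u \<in> ball x (d x)" "v \<in> ball x (d x)" by blast+
          then have "norm (u - x) < d x" "norm (v - x) < d x"
            by (simp_all add: dist_norm norm_minus_commute)
          then have "norm (f u - f x - (u - x) *\<^sub>R f' x) \<le> \<epsilon> * norm (u - x)"
            "norm (f v - f x - (v - x) *\<^sub>R f' x) \<le> \<epsilon> * norm (v - x)"
            using uv False by (intro d; simp)+
          moreover have "(v - u) *\<^sub>R f' x - (f v - f u)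
              = (f u - f x - (u - x) *\<^sub>R f' x) - (f v - f x - (v - x) *\<^sub>R f' x)"
            by (simp add: algebra_simps)
          ultimately have "norm ((v - u) *\<^sub>R f' x - (f v - f u)) \<le> \<epsilon> * norm (u - x) + \<epsilon> * norm (v - x)"
            by (simp only:) (rule norm_triangle_le_diff, rule add_mono)
          \<comment> \<open>The tag lies between the endpoints, so its two distances to them add up
            to the length of the interval.\<close>
          also have "\<dots> = \<epsilon> * (v - u)" using uv by (auto simp: algebra_simps)
          finally show ?thesis using False uv by (simp add: g_def)
        qed
      qed
      also have "\<dots> = \<epsilon> * (b - a) + (\<Sum>(x, K)\<in>p. if x \<in> N then F K else 0)"
        unfolding ba by (simp add: split_def sum.distrib sum_distrib_left)
      also have "(\<Sum>(x, K)\<in>p. if x \<in> N then F K else 0) = (\<Sum>(x, K)\<in>p1. F K)"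
        unfolding p1_def using fin by (intro sum.mono_neutral_cong_right) (auto split: if_splits)
      also have "(\<Sum>(x, K)\<in>p1. F K) < e / 2"
      proof -
        have "p1 tagged_partial_division_of cbox a b"
          using p(1) by (intro tagged_partial_division_subset[of p _ p1])
             (auto simp: tagged_division_of_def p1_def)
        then have p1: "p1 tagged_division_of \<Union>(snd ` p1)"
          by (rule tagged_partial_division_of_Union_self)
        then have D: "snd ` p1 division_of \<Union>(snd ` p1)"
          by (rule division_of_tagged_division)
        have "(\<Sum>(x, K)\<in>p1. F K) = (\<Sum>K\<in>snd ` p1. F K)"
          by (rule sum.over_tagged_division_lemma[OF p1]) (simp add: F_def box_eq_empty)
        also have "\<dots> = (\<Sum>K\<in>snd ` p1. norm (f (Sup K) - f (Inf K)))"
          using division_ofD(3)[OF D] by (intro sum.cong refl) (simp add: F_def)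
        also have "\<dots> < e / 2"
        proof (rule \<delta>[OF D])
          show "\<Union>(snd ` p1) \<subseteq> {a..b}"
          proof (rule Union_least)
            fix K assume "K \<in> snd ` p1"
            then obtain x where "(x, K) \<in> p" by (auto simp: p1_def)
            then show "K \<subseteq> {a..b}" using tagged_division_ofD(3)[OF p(1)] by simp
          qed
          \<comment> \<open>All intervals tagged in \<open>N\<close> lie in \<open>U\<close>, so
            their total length is at most the measure of \<open>U\<close>, which is below the
            \<open>\<delta>\<close> of absolute continuity.\<close>
          have "\<Union>(snd ` p1) \<subseteq> U"
          proof (rule Union_least)
            fix K assume "K \<in> snd ` p1"
            then obtain x where "(x, K) \<in> p" "x \<in> N" by (auto simp: p1_def)
            then show "K \<subseteq> U" using fine[of x K] by (simp add: \<gamma>_def)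
          qed
          then have "(\<Sum>K\<in>snd ` p1. Sup K - Inf K) \<le> measure lebesgue U"
            by (rule division_length_le_measure[OF D _ U(3)])
          then show "(\<Sum>K\<in>snd ` p1. Sup K - Inf K) < \<delta>"
            using U(4) by (rule le_less_trans)
        qed
        finally show ?thesis .
      qed
      finally show "norm ((\<Sum>(x, K)\<in>p. measure lborel K *\<^sub>R g x) - (f b - f a)) < e"
        using \<epsilon> by linarith
    qed
  qed
  then show ?thesis
    using has_integral_spike[OF N, of "{a..b}" f' g] by (auto simp: g_def)
qed

subsection \<open>Indefinite integrals\<close>

text \<open>\<open>integrable_ccontinuous_explicit\<close> controls averages over
  \<open>{x..x + t}\<close>, that is, the right-hand derivative off a null set. Applying it to the
  reflected function \<open>h (- x)\<close> as well gives the left-hand derivative, and the two null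
  sets are united.\<close>

lemma indefinite_integral_has_vector_derivative_negligible:
  fixes f :: "real \<Rightarrow> 'a::euclidean_space"
  assumes f: "f integrable_on {a..b}"
  obtains N where "negligible N"
    "\<And>x. x \<in> {a..b} - N \<Longrightarrow>
       ((\<lambda>u. integral {a..u} f) has_vector_derivative f x) (at x within {a..b})"
proof -
  \<comment> \<open>Extension by zero makes the integrand integrable on every interval, on both
    sides of the origin, so that it may be reflected.\<close>
  define h where "h x = (if x \<in> {a..b} then f x else 0)" for x
  have "h integrable_on UNIV"
    using f unfolding h_def by (subst integrable_restrict_UNIV)
  then have h: "h integrable_on cbox u v" for u v
    by (rule integrable_on_subcbox) simp
  have h': "(\<lambda>x. h (- x)) integrable_on cbox u v" for u v
    using h[of "- v" "- u"] Henstock_Kurzweil_Integration.integrable_reflect_real[where f = h and a = "- v" and b = "- u"] by simp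
  obtain N1 where N1: "negligible N1" "\<And>x e. \<lbrakk>x \<notin> N1; 0 < e\<rbrakk> \<Longrightarrow>
      \<exists>d>0. \<forall>t. 0 < t \<and> t < d \<longrightarrow> norm (integral (cbox x (x + t *\<^sub>R One)) h /\<^sub>R t ^ DIM(real) - h x) < e"
    by (rule integrable_ccontinuous_explicit[OF h]) (rule that)
  obtain N2 where N2: "negligible N2" "\<And>x e. \<lbrakk>x \<notin> N2; 0 < e\<rbrakk> \<Longrightarrow>
      \<exists>d>0. \<forall>t. 0 < t \<and> t < d \<longrightarrow>
        norm (integral (cbox x (x + t *\<^sub>R One)) (\<lambda>x. h (- x)) /\<^sub>R t ^ DIM(real) - h (- x)) < e"
    by (rule integrable_ccontinuous_explicit[OF h']) (rule that)
  \<comment> \<open>The exceptional set of the reflected function is reflected back. With the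
    endpoints excluded too, every remaining point is interior.\<close>
  define N where "N = N1 \<union> uminus ` N2 \<union> {a, b}"
  have "negligible (uminus ` N2)"
    using N2(1) by (intro negligible_differentiable_image_negligible)
      (auto simp: differentiable_on_def intro!: differentiable_minus)
  then have "negligible N"
    unfolding N_def using N1(1) by (intro negligible_Un negligible_insert[THEN iffD2]) auto
  moreover have "((\<lambda>u. integral {a..u} f) has_vector_derivative f x) (at x within {a..b})"
    if x: "x \<in> {a..b} - N" for x
  proof -
    have ab: "a < x" "x < b" and xN: "x \<notin> N1" "- x \<notin> N2" and hx: "h x = f x"
      using x unfolding N_def h_def by (auto simp: image_iff)
    have I: "integral {u..v} h = integral {a..v} f - integral {a..u} f"
      if "a \<le> u" "u \<le> v" "v \<le> b" for u v
    proof -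
      have "integral {a..u} f + integral {u..v} f = integral {a..v} f"
        using that by (intro Henstock_Kurzweil_Integration.integral_combine integrable_on_subinterval[OF f]) auto
      moreover have "integral {u..v} h = integral {u..v} f"
        using that by (intro integral_cong) (auto simp: h_def)
      ultimately show ?thesis by (simp add: algebra_simps)
    qed
    show ?thesis
      unfolding has_vector_derivative_def has_derivative_within_alt
    proof (intro conjI allI impI)
      fix e :: real
      assume "e > 0"
      obtain d1 where d1: "d1 > 0" "\<And>t. 0 < t \<Longrightarrow> t < d1 \<Longrightarrow> norm (integral {x..x + t} h /\<^sub>R t - h x) < e"
        using N1(2)[OF xN(1) \<open>e > 0\<close>] by auto
      obtain d2 where d2: "d2 > 0"
        "\<And>t. 0 < t \<Longrightarrow> t < d2 \<Longrightarrow> norm (integral {- x..- x + t} (\<lambda>x. h (- x)) /\<^sub>R t - h x) < e"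
        using N2(2)[OF xN(2) \<open>e > 0\<close>] by auto
      have *: "norm (J - t *\<^sub>R f x) \<le> e * t" if "t > 0" "norm (J /\<^sub>R t - h x) < e" for J t
      proof -
        have "norm (J - t *\<^sub>R f x) = norm (t *\<^sub>R (J /\<^sub>R t - h x))"
          using that(1) by (simp add: scaleR_diff_right hx)
        also have "\<dots> = t * norm (J /\<^sub>R t - h x)" using that(1) by simp
        also have "\<dots> \<le> t * e" using that by (intro mult_left_mono) auto
        finally show ?thesis by (simp add: mult.commute)
      qed
      show "\<exists>d>0. \<forall>y\<in>{a..b}. norm (y - x) < d \<longrightarrow>
          norm (integral {a..y} f - integral {a..x} f - (y - x) *\<^sub>R f x) \<le> e * norm (y - x)"
      proof (intro exI[of _ "min d1 d2"] conjI ballI impI)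
        fix y assume y: "y \<in> {a..b}" "norm (y - x) < min d1 d2"
        consider "y = x" | "x < y" | "y < x" by linarith
        then show "norm (integral {a..y} f - integral {a..x} f - (y - x) *\<^sub>R f x) \<le> e * norm (y - x)"
        proof cases
          case 2
          then have "norm (integral {x..x + (y - x)} h - (y - x) *\<^sub>R f x) \<le> e * (y - x)"
            using y by (intro * d1) auto
          then show ?thesis using 2 I[of x y] y ab by simp
        next
          case 3
          then have "norm (integral {- x..- x + (x - y)} (\<lambda>x. h (- x)) - (x - y) *\<^sub>R f x) \<le> e * (x - y)"
            using y by (intro * d2) auto
          moreover have "integral {- x..- y} (\<lambda>x. h (- x)) = integral {y..x} h"
            by (rule Henstock_Kurzweil_Integration.integral_reflect_real)
          ultimately have "norm (integral {a..x} f - integral {a..y} f - (x - y) *\<^sub>R f x) \<le> e * (x - y)"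
            using 3 I[of y x] y ab by simp
          moreover have "integral {a..y} f - integral {a..x} f - (y - x) *\<^sub>R f x
              = - (integral {a..x} f - integral {a..y} f - (x - y) *\<^sub>R f x)"
            by (simp add: algebra_simps)
          ultimately show ?thesis using 3 by (simp only: norm_minus_cancel) simp
        qed simp
      qed (use d1(1) d2(1) in simp)
    qed (rule bounded_linear_scaleR_left)
  qed
  ultimately show thesis by (rule that)
qed

text \<open>Truncation: \<open>norm (f x)\<close> is split into its minimum with a large
  \<open>n\<close> and a remainder \<open>k\<close> whose integral over the whole interval is below
  \<open>e / 2\<close>. The bounded part contributes at most \<open>n\<close> times the total length
  of the division, so the choice of \<open>n\<close> has to precede that of
  \<open>d\<close>.\<close>

lemma absolutely_continuous_on_indefinite_integral:
  fixes f :: "real \<Rightarrow> 'a::euclidean_space"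
  assumes f: "f absolutely_integrable_on {a..b}"
  shows "absolutely_continuous_on {a..b} (\<lambda>u. integral {a..u} f)"
  unfolding absolutely_continuous_on_def
proof (intro allI impI)
  fix e :: real
  assume "e > 0"
  define g where "g n x = min (norm (f x)) (real n)" for n x
  have nf: "(\<lambda>x. norm (f x)) absolutely_integrable_on {a..b}"
    using set_integrable_norm[OF f] .
  have g: "g n integrable_on {a..b}" for n
    unfolding g_def
    by (rule set_lebesgue_integral_eq_integral(1), rule absolutely_integrable_min_1[OF nf])
       (rule absolutely_integrable_continuous_real[OF continuous_on_const])
  have "(\<lambda>n. integral {a..b} (g n)) \<longlonglongrightarrow> integral {a..b} (\<lambda>x. norm (f x))"
  proof (rule dominated_convergence(2)[OF g])
    show "(\<lambda>x. norm (f x)) integrable_on {a..b}"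
      using nf by (rule set_lebesgue_integral_eq_integral(1))
    show "(\<lambda>n. g n x) \<longlonglongrightarrow> norm (f x)" for x
    proof (rule tendsto_eventually)
      obtain n0 where "norm (f x) \<le> real n0" using real_arch_simple by blast
      then show "\<forall>\<^sub>F n in sequentially. g n x = norm (f x)"
        unfolding g_def eventually_sequentially by (intro exI[of _ n0]) auto
    qed
  qed (auto simp: g_def)
  then obtain n where n: "\<bar>integral {a..b} (g n) - integral {a..b} (\<lambda>x. norm (f x))\<bar> < e / 2"
    using \<open>e > 0\<close> unfolding LIMSEQ_iff by (metis half_gt_zero order_refl real_norm_def)
  define k where "k x = norm (f x) - g n x" for x
  have k: "k integrable_on {a..b}" "\<And>x. k x \<ge> 0"
    using integrable_diff[OF set_lebesgue_integral_eq_integral(1)[OF nf] g[of n]]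
    by (simp_all add: k_def[abs_def] g_def)
  have "integral {a..b} k = integral {a..b} (\<lambda>x. norm (f x)) - integral {a..b} (g n)"
    unfolding k_def
    by (intro Henstock_Kurzweil_Integration.integral_diff set_lebesgue_integral_eq_integral(1)[OF nf] g)
  then have k': "integral {a..b} k < e / 2"
    using n by linarith
  \<comment> \<open>Dividing by \<open>real n + 1\<close> rather than \<open>real n\<close> allows
    \<open>n = 0\<close> and yields the strict bound \<open>real n * d < e / 2\<close>.\<close>
  define d where "d = e / (2 * (real n + 1))"
  have d: "d > 0" "real n * d < e / 2"
    using \<open>e > 0\<close> by (auto simp: d_def field_simps)
  show "\<exists>d>0. \<forall>D. D division_of \<Union>D \<and> \<Union>D \<subseteq> {a..b} \<and> (\<Sum>K\<in>D. Sup K - Inf K) < d \<longrightarrow>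
          (\<Sum>K\<in>D. norm (integral {a..Sup K} f - integral {a..Inf K} f)) < e"
  proof (intro exI[of _ d] conjI allI impI d(1); (elim conjE)?)
    fix D :: "real set set"
    assume D: "D division_of \<Union>D" "\<Union>D \<subseteq> {a..b}" "(\<Sum>K\<in>D. Sup K - Inf K) < d"
    have kK: "k integrable_on K" if "K \<in> D" for K
    proof -
      have "K = {Inf K..Sup K}" "K \<subseteq> {a..b}" using division_of_endpoints[OF D(1) that] D(2) that by auto
      then show ?thesis using integrable_on_subinterval[OF k(1), of "Inf K" "Sup K"] by simp
    qed
    have "(\<Sum>K\<in>D. norm (integral {a..Sup K} f - integral {a..Inf K} f))
        \<le> (\<Sum>K\<in>D. integral K k + real n * (Sup K - Inf K))"
    proof (rule sum_mono)
      fix K assume K: "K \<in> D"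
      define u v where "u = Inf K" and "v = Sup K"
      have uv: "u \<le> v" "K = {u..v}" "a \<le> u" "v \<le> b"
        using division_of_endpoints[OF D(1) K] D(2) by (auto simp: u_def v_def subset_iff)
      have fi: "f integrable_on {a..v}" "f integrable_on {u..v}"
        using uv by (auto intro!: integrable_on_subinterval[OF set_lebesgue_integral_eq_integral(1)[OF f]])
      have "integral {a..u} f + integral {u..v} f = integral {a..v} f"
        using uv fi by (intro Henstock_Kurzweil_Integration.integral_combine) auto
      then have "integral {a..v} f - integral {a..u} f = integral {u..v} f"
        by (simp add: algebra_simps)
      moreover have "norm (integral {u..v} f) \<le> integral {u..v} (\<lambda>x. k x + real n)"
      proof (rule integral_norm_bound_integral[OF fi(2)])
        show "(\<lambda>x. k x + real n) integrable_on {u..v}"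
          using kK[OF K] uv by (intro integrable_add) auto
      qed (auto simp: k_def g_def)
      moreover have "\<dots> = integral {u..v} k + real n * (v - u)"
        using kK[OF K] uv by (subst Henstock_Kurzweil_Integration.integral_add) auto
      ultimately show "norm (integral {a..Sup K} f - integral {a..Inf K} f)
          \<le> integral K k + real n * (Sup K - Inf K)"
        using uv unfolding u_def v_def by simp
    qed
    also have "\<dots> = integral (\<Union>D) k + real n * (\<Sum>K\<in>D. Sup K - Inf K)"
      using integral_combine_division_bottomup[OF D(1) kK] by (simp add: sum.distrib sum_distrib_left)
    also have "integral (\<Union>D) k \<le> integral {a..b} k"
      using D(2) k integrable_combine_division[OF D(1) kK] by (intro integral_subset_le) auto
    also have "real n * (\<Sum>K\<in>D. Sup K - Inf K) \<le> real n * d"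
      using D(3) by (intro mult_left_mono) auto
    finally show "(\<Sum>K\<in>D. norm (integral {a..Sup K} f - integral {a..Inf K} f)) < e"
      using k' d(2) by linarith
  qed
qed

subsection \<open>Amplitudes of the two modes\<close>

lemma has_integral_norm_le:
  fixes f :: "'n::euclidean_space \<Rightarrow> 'a::banach"
  assumes "(f has_integral I) S" "(g has_integral J) S" "\<And>x. x \<in> S \<Longrightarrow> norm (f x) \<le> g x"
  shows "norm I \<le> J"
  using Henstock_Kurzweil_Integration.integral_norm_bound_integral[of f S g] assms
  by (metis has_integral_iff)

lemma has_integral_exp_linear:
  fixes c k x :: real
  assumes "k \<noteq> 0" "0 \<le> x"
  shows "((\<lambda>t. c * exp (k * t)) has_integral (c * (exp (k * x) - 1) / k)) {0..x}"
proof -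
  have "((\<lambda>t. c * exp (k * t)) has_integral (c * exp (k * x) / k - c * exp (k * 0) / k)) {0..x}"
    using assms by (intro fundamental_theorem_of_calculus)
      (auto intro!: derivative_eq_intros simp flip: has_real_derivative_iff_has_vector_derivative)
  then show ?thesis by (simp add: diff_divide_distrib right_diff_distrib)
qed

text \<open>
  In the application \<open>r\<close> and \<open>p\<close> are the slowly varying amplitudes of the growing and the decaying
  mode. Each step from \<open>r\<close> to \<open>p\<close> and back gains a factor \<open>m\<^sup>2 a / (2 \<alpha>)\<close>, so the
  supremum of \<open>\<bar>r\<bar>\<close> can be absorbed.
\<close>

lemma coupled_amplitudes_estimate:
  fixes p r G H :: "real \<Rightarrow> complex"
  assumes "0 \<le> m" "0 < \<alpha>" "m \<le> \<alpha>" "m\<^sup>2 * a \<le> \<alpha>"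
    and r: "continuous_on {0..a} r"
    and G: "\<And>x. x \<in> {0..a} \<Longrightarrow> (G has_integral (p x - p 0)) {0..x}"
    and H: "\<And>x. x \<in> {0..a} \<Longrightarrow> (H has_integral (r x - r 0)) {0..x}"
    and G_le: "\<And>t. t \<in> {0..a} \<Longrightarrow> norm (G t) \<le> m * exp (2 * \<alpha> * t) * norm (r t)"
    and H_le: "\<And>t. t \<in> {0..a} \<Longrightarrow> norm (H t) \<le> m * exp (- 2 * \<alpha> * t) * norm (p t)"
    and init: "norm (p 0) \<le> 1" "norm (r 0) \<le> 1"
    and x: "x \<in> {0..a}"
  shows "norm (r x - r 0) \<le> (m + 3 * m\<^sup>2 * a) / (2 * \<alpha>)"
    and "exp (- 2 * \<alpha> * x) * norm (p x - p 0) \<le> 3 * m / (2 * \<alpha>)"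
proof -
  have "0 \<le> a" using x by simp
  \<comment> \<open>Continuity on a compact interval makes the supremum of \<open>norm (r t)\<close>
    finite before any estimate is available; otherwise it could not be absorbed later.\<close>
  obtain x0 where x0: "x0 \<in> {0..a}" "\<And>t. t \<in> {0..a} \<Longrightarrow> norm (r t) \<le> norm (r x0)"
    using continuous_attains_sup[of "{0..a}" "\<lambda>t. norm (r t)"] r x
    by (metis atLeastatMost_empty_iff2 compact_Icc continuous_on_norm empty_iff)
  define M where "M = norm (r x0)"
  have M: "0 \<le> M" "\<And>t. t \<in> {0..a} \<Longrightarrow> norm (r t) \<le> M"
    using x0 by (simp_all add: M_def)
  have p: "norm (p y - p 0) \<le> m * M * exp (2 * \<alpha> * y) / (2 * \<alpha>)" if y: "y \<in> {0..a}" for y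
  proof -
    have "norm (p y - p 0) \<le> m * M * (exp ((2 * \<alpha>) * y) - 1) / (2 * \<alpha>)"
    proof (rule has_integral_norm_le[OF G[OF y] has_integral_exp_linear])
      fix t assume t: "t \<in> {0..y}"
      then have "norm (G t) \<le> m * exp (2 * \<alpha> * t) * norm (r t)" using y by (intro G_le) auto
      also have "\<dots> \<le> m * exp (2 * \<alpha> * t) * M"
        using t y assms(1) by (intro mult_left_mono M) auto
      finally show "norm (G t) \<le> m * M * exp ((2 * \<alpha>) * t)" by (simp add: mult_ac)
    qed (use y assms in auto)
    also have "\<dots> \<le> m * M * exp (2 * \<alpha> * y) / (2 * \<alpha>)"
      using assms M(1) by (intro divide_right_mono mult_left_mono) auto
    finally show ?thesis .
  qed
  have r_le: "norm (r y - r 0) \<le> (m + m\<^sup>2 * M * a) / (2 * \<alpha>)" if y: "y \<in> {0..a}" for y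
  proof -
    \<comment> \<open>\<open>norm (p t)\<close> is split at \<open>p 0\<close>. The initial value
      leaves the decaying weight \<open>exp (- 2 * \<alpha> * t)\<close>, which integrates to at
      most \<open>1 / (2 * \<alpha>)\<close>. In the bound for \<open>p t - p 0\<close> the growth
      cancels this weight exactly, so a constant remains and integration gives the factor
      \<open>y\<close>.\<close>
    have "norm (r y - r 0) \<le> m * (exp ((- 2 * \<alpha>) * y) - 1) / (- 2 * \<alpha>) + m\<^sup>2 * M / (2 * \<alpha>) * y"
    proof (rule has_integral_norm_le[OF H[OF y]])
      show "((\<lambda>t. m * exp ((- 2 * \<alpha>) * t) + m\<^sup>2 * M / (2 * \<alpha>)) has_integral
          (m * (exp ((- 2 * \<alpha>) * y) - 1) / (- 2 * \<alpha>) + m\<^sup>2 * M / (2 * \<alpha>) * y)) {0..y}"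
        using y assms has_integral_const_real[of "m\<^sup>2 * M / (2 * \<alpha>)" 0 y]
        by (intro has_integral_add has_integral_exp_linear) (auto simp: mult.commute)
      fix t assume t: "t \<in> {0..y}"
      then have ta: "t \<in> {0..a}" using y by auto
      have "norm (p t) \<le> norm (p t - p 0) + norm (p 0)"
        by (metis diff_add_cancel norm_triangle_ineq)
      also have "\<dots> \<le> m * M * exp (2 * \<alpha> * t) / (2 * \<alpha>) + 1"
        using p[OF ta] init(1) by (rule add_mono)
      finally have "norm (H t) \<le> m * exp (- 2 * \<alpha> * t) * (m * M * exp (2 * \<alpha> * t) / (2 * \<alpha>) + 1)"
        using assms(1) by (intro order_trans[OF H_le[OF ta]] mult_left_mono) auto
      also have "\<dots> = m * exp ((- 2 * \<alpha>) * t) + m\<^sup>2 * M / (2 * \<alpha>) * (exp (- 2 * \<alpha> * t) * exp (2 * \<alpha> * t))"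
        by (simp add: algebra_simps power2_eq_square)
      also have "exp (- 2 * \<alpha> * t) * exp (2 * \<alpha> * t) = 1"
        by (simp flip: exp_add)
      finally show "norm (H t) \<le> m * exp ((- 2 * \<alpha>) * t) + m\<^sup>2 * M / (2 * \<alpha>)" by simp
    qed
    also have "m * (exp ((- 2 * \<alpha>) * y) - 1) / (- 2 * \<alpha>) = m * (1 - exp ((- 2 * \<alpha>) * y)) / (2 * \<alpha>)"
      using assms(2) by (simp add: field_simps)
    also have "\<dots> + m\<^sup>2 * M / (2 * \<alpha>) * y \<le> m * 1 / (2 * \<alpha>) + m\<^sup>2 * M / (2 * \<alpha>) * a"
      using assms M(1) y by (intro add_mono divide_right_mono mult_left_mono) auto
    also have "\<dots> = (m + m\<^sup>2 * M * a) / (2 * \<alpha>)"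
      by (simp add: add_divide_distrib)
    finally show ?thesis .
  qed
  have "M \<le> norm (r x0 - r 0) + norm (r 0)"
    unfolding M_def by (metis diff_add_cancel norm_triangle_ineq)
  also have "\<dots> \<le> (m + m\<^sup>2 * M * a) / (2 * \<alpha>) + 1"
    using r_le[OF x0(1)] init(2) by (rule add_mono)
  finally have "2 * \<alpha> * M \<le> m + (m\<^sup>2 * a) * M + 2 * \<alpha>"
    using assms(2) by (simp add: field_simps)
  \<comment> \<open>This absorbs the supremum: \<open>m \<le> \<alpha>\<close> and
    \<open>m\<^sup>2 * a \<le> \<alpha>\<close> leave
    \<open>\<alpha> * M \<le> 3 * \<alpha>\<close>, the origin of the factor 3 in both
    bounds.\<close>
  also have "\<dots> \<le> \<alpha> + \<alpha> * M + 2 * \<alpha>"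
    using assms M(1) by (intro add_mono mult_right_mono) auto
  finally have "\<alpha> * M \<le> \<alpha> * 3" by (simp add: algebra_simps)
  then have M3: "M \<le> 3" using assms(2) by simp
  have "norm (r x - r 0) \<le> (m + m\<^sup>2 * a * M) / (2 * \<alpha>)"
    using r_le[OF x] by (simp add: mult_ac)
  also have "\<dots> \<le> (m + m\<^sup>2 * a * 3) / (2 * \<alpha>)"
    using assms M3 \<open>0 \<le> a\<close> by (intro divide_right_mono add_mono mult_left_mono) auto
  finally show "norm (r x - r 0) \<le> (m + 3 * m\<^sup>2 * a) / (2 * \<alpha>)" by (simp add: mult_ac)
  have "exp (- 2 * \<alpha> * x) * norm (p x - p 0)
      \<le> exp (- 2 * \<alpha> * x) * (m * M * exp (2 * \<alpha> * x) / (2 * \<alpha>))"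
    using p[OF x] by (rule mult_left_mono) simp
  also have "\<dots> = m * M / (2 * \<alpha>) * (exp (- 2 * \<alpha> * x) * exp (2 * \<alpha> * x))"
    by simp
  also have "exp (- 2 * \<alpha> * x) * exp (2 * \<alpha> * x) = 1"
    by (simp flip: exp_add)
  also have "m * M / (2 * \<alpha>) * 1 \<le> m * 3 / (2 * \<alpha>) * 1"
    using assms M3 by (intro mult_right_mono divide_right_mono mult_left_mono) auto
  finally show "exp (- 2 * \<alpha> * x) * norm (p x - p 0) \<le> 3 * m / (2 * \<alpha>)" by simp
qed

text \<open>In the derivative of \<open>exp (- k t) * y t\<close> the terms with \<open>k'\<close>
  cancel off \<open>N\<close>, and absolute continuity of the product permits integrating what is
  left.\<close>

lemma has_integral_integrating_factor:
  fixes y k k' g :: "real \<Rightarrow> complex"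
  assumes y: "absolutely_continuous_on {0..a} y" and k: "absolutely_continuous_on {0..a} k"
    and N: "negligible N"
    and dy: "\<And>t. t \<in> {0..a} - N \<Longrightarrow> (y has_vector_derivative k' t * y t + g t) (at t within {0..a})"
    and dk: "\<And>t. t \<in> {0..a} - N \<Longrightarrow> (k has_vector_derivative k' t) (at t within {0..a})"
    and x: "x \<in> {0..a}"
  shows "((\<lambda>t. exp (- k t) * g t) has_integral exp (- k x) * y x - exp (- k 0) * y 0) {0..x}"
proof -
  have sub: "{0..x} \<subseteq> {0..a}" using x by auto
  have mk: "absolutely_continuous_on {0..a} (\<lambda>t. - k t)"
    by (rule absolutely_continuous_on_dominated[OF k k, where A = 1 and B = 0])
       (simp add: norm_minus_commute)
  have ac: "absolutely_continuous_on {0..x} (\<lambda>t. exp (- k t) * y t)"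
    by (rule absolutely_continuous_on_subset[OF _ sub])
       (intro absolutely_continuous_on_mult absolutely_continuous_on_exp mk y)
  have "((\<lambda>t. exp (- k t) * y t) has_vector_derivative exp (- k t) * g t) (at t within {0..x})"
    if t: "t \<in> {0..x} - N" for t
  proof -
    have t': "t \<in> {0..a} - N" using t sub by auto
    have "((\<lambda>t. - k t) has_vector_derivative - k' t) (at t within {0..a})"
      by (intro has_vector_derivative_minus dk t')
    then have "((exp \<circ> (\<lambda>t. - k t)) has_vector_derivative - k' t * exp (- k t)) (at t within {0..a})"
      by (rule field_vector_diff_chain_within) (intro DERIV_exp has_field_derivative_at_within)
    then have "((\<lambda>t. exp (- k t) * y t) has_vector_derivative
        exp (- k t) * (k' t * y t + g t) + (- k' t * exp (- k t)) * y t) (at t within {0..a})"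
      unfolding o_def by (intro has_vector_derivative_mult dy t')
    then have "((\<lambda>t. exp (- k t) * y t) has_vector_derivative exp (- k t) * g t) (at t within {0..a})"
      by (simp add: algebra_simps)
    then show ?thesis by (rule has_vector_derivative_within_subset[OF _ sub])
  qed
  then show ?thesis
    using x by (intro fundamental_theorem_of_calculus_absolutely_continuous[OF _ ac N]) auto
qed

text \<open>The amplitude bounds translate back because \<open>k 0 = 0\<close>, so that amplitudes
  and modes have the same initial values, and because \<open>exp (- \<alpha> * x)\<close> times
  \<open>exp (k x)\<close> has modulus 1, while its product with \<open>exp (- k x)\<close> has
  modulus \<open>exp (- 2 * \<alpha> * x)\<close>, precisely the weight in the bound for
  \<open>p\<close>.\<close>

lemma dirac_mode_asymptotics:
  fixes P R :: "real \<Rightarrow> complex" and q :: "real \<Rightarrow> real"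
  assumes m: "0 \<le> m" "0 < \<alpha>" "m \<le> \<alpha>" "m\<^sup>2 * a \<le> \<alpha>"
    and q: "q absolutely_integrable_on {0..a}"
    and P: "absolutely_continuous_on {0..a} P" and R: "absolutely_continuous_on {0..a} R"
    and N: "negligible N"
    and dP: "\<And>t. t \<in> {0..a} - N \<Longrightarrow> (P has_vector_derivative
          - (\<alpha> + \<i> * (q t - \<mu>)) * P t + (- \<i> * m * R t)) (at t within {0..a})"
    and dR: "\<And>t. t \<in> {0..a} - N \<Longrightarrow> (R has_vector_derivative
          (\<alpha> + \<i> * (q t - \<mu>)) * R t + \<i> * m * P t) (at t within {0..a})"
    and init: "norm (P 0) \<le> 1" "norm (R 0) \<le> 1"
    and x: "x \<in> {0..a}"
  defines "\<theta> \<equiv> \<lambda>x. integral {0..x} q - \<mu> * x"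
  shows "norm (exp (- \<alpha> * x) *\<^sub>R R x - exp (\<i> * \<theta> x) * R 0) \<le> (m + 3 * m\<^sup>2 * a) / (2 * \<alpha>)"
    and "norm (exp (- \<alpha> * x) *\<^sub>R P x - of_real (exp (- 2 * \<alpha> * x)) * exp (- \<i> * \<theta> x) * P 0) \<le> 3 * m / (2 * \<alpha>)"
proof -
  define k where "k t = complex_of_real (\<alpha> * t) + \<i> * complex_of_real (\<theta> t)" for t
  define k' where "k' t = \<alpha> + \<i> * (q t - \<mu>)" for t
  \<comment> \<open>Increments of \<open>k\<close> are dominated by those of \<open>x\<close> and of
    the integral of \<open>q\<close>; nothing beyond the integrability of \<open>q\<close> is
    used.\<close>
  have ack: "absolutely_continuous_on {0..a} k"
  proof (rule absolutely_continuous_on_dominated[OF absolutely_continuous_on_ident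
        absolutely_continuous_on_indefinite_integral[OF q], where A = "\<bar>\<alpha>\<bar> + \<bar>\<mu>\<bar>" and B = 1])
    fix u v :: real
    have "k v - k u = of_real (\<alpha> * (v - u)) + \<i> * of_real (integral {0..v} q - integral {0..u} q)
        - \<i> * of_real (\<mu> * (v - u))"
      by (simp add: k_def \<theta>_def algebra_simps)
    then have "norm (k v - k u) \<le> norm (complex_of_real (\<alpha> * (v - u)))
        + norm (\<i> * of_real (integral {0..v} q - integral {0..u} q)) + norm (\<i> * of_real (\<mu> * (v - u)))"
      by (metis norm_triangle_ineq norm_triangle_le_diff add_right_mono order_refl)
    then show "norm (k v - k u) \<le> (\<bar>\<alpha>\<bar> + \<bar>\<mu>\<bar>) * norm (v - u)
        + 1 * norm (integral {0..v} q - integral {0..u} q)"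
      by (simp add: norm_mult abs_mult distrib_right del: of_real_mult of_real_diff)
  qed
  obtain N' where N': "negligible N'" "\<And>t. t \<in> {0..a} - N' \<Longrightarrow>
      ((\<lambda>u. integral {0..u} q) has_vector_derivative q t) (at t within {0..a})"
    by (rule indefinite_integral_has_vector_derivative_negligible[OF
          set_lebesgue_integral_eq_integral(1)[OF q]]) (rule that)
  have dk: "(k has_vector_derivative k' t) (at t within {0..a})" if "t \<in> {0..a} - (N \<union> N')" for t
  proof -
    have "((\<lambda>u. integral {0..u} q) has_vector_derivative q t) (at t within {0..a})"
      using that N'(2) by auto
    then have "(\<theta> has_vector_derivative q t - \<mu>) (at t within {0..a})"
      unfolding \<theta>_def by (auto intro!: derivative_eq_intros has_vector_derivative_diff
        simp flip: has_real_derivative_iff_has_vector_derivative)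
    then have "((\<lambda>t. complex_of_real (\<alpha> * t) + \<i> * complex_of_real (\<theta> t)) has_vector_derivative
        complex_of_real \<alpha> + \<i> * complex_of_real (q t - \<mu>)) (at t within {0..a})"
      by (intro has_vector_derivative_add has_vector_derivative_mult_right has_vector_derivative_of_real)
         (auto intro!: derivative_eq_intros simp flip: has_real_derivative_iff_has_vector_derivative)
    then show ?thesis by (simp add: k_def[abs_def] k'_def)
  qed
  have ackm: "absolutely_continuous_on {0..a} (\<lambda>t. - k t)"
    by (rule absolutely_continuous_on_dominated[OF ack ack, where A = 1 and B = 0])
       (simp add: norm_minus_commute)
  have \<theta>0: "\<theta> 0 = 0" by (simp add: \<theta>_def)
  then have k0: "k 0 = 0" by (simp add: k_def)
  have nk: "norm (exp (k t)) = exp (\<alpha> * t)" "norm (exp (- k t)) = exp (- \<alpha> * t)" for t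
    by (simp_all add: k_def)
  define p where "p t = exp (k t) * P t" for t
  define r where "r t = exp (- k t) * R t" for t
  have PR: "P t = exp (- k t) * p t" "R t = exp (k t) * r t" for t
    by (simp_all add: p_def r_def exp_minus field_simps)
  have N'': "negligible (N \<union> N')" using N N'(1) by (rule negligible_Un)
  have contr: "continuous_on {0..a} r"
    unfolding r_def using R ackm
    by (intro absolutely_continuous_on_imp_continuous_on absolutely_continuous_on_mult
        absolutely_continuous_on_exp)
  have G: "((\<lambda>t. exp (k t) * (- \<i> * m * R t)) has_integral p y - p 0) {0..y}" if "y \<in> {0..a}" for y
  proof -
    \<comment> \<open>The equation for \<open>P\<close> has the coefficient \<open>- k'\<close>, so
      the integrating factor is taken for the phase \<open>- k\<close>; this is the source of the
      double minus signs.\<close>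
    have "((\<lambda>t. - k t) has_vector_derivative - k' t) (at t within {0..a})"
      if "t \<in> {0..a} - (N \<union> N')" for t
      using dk[OF that] by (rule has_vector_derivative_minus)
    then have "((\<lambda>t. exp (- (- k t)) * (- \<i> * m * R t)) has_integral
        exp (- (- k y)) * P y - exp (- (- k 0)) * P 0) {0..y}"
      using dP that
      by (intro has_integral_integrating_factor[OF P ackm N'', where k' = "\<lambda>t. - k' t"])
         (auto simp: k'_def)
    then show ?thesis by (simp add: p_def)
  qed
  have H: "((\<lambda>t. exp (- k t) * (\<i> * m * P t)) has_integral r y - r 0) {0..y}" if "y \<in> {0..a}" for y
    using has_integral_integrating_factor[OF R ack N'', of k' "\<lambda>t. \<i> * m * P t" y] dR dk that
    unfolding r_def k'_def by auto
  have e2: "exp (2 * \<alpha> * t) = exp (\<alpha> * t) * exp (\<alpha> * t)"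
    "exp (- (2 * \<alpha> * t)) = exp (- (\<alpha> * t)) * exp (- (\<alpha> * t))" for t
    by (simp_all flip: exp_add)
  have "norm (exp (k t) * (- \<i> * m * R t)) \<le> m * exp (2 * \<alpha> * t) * norm (r t)" for t
    using m(1) by (simp add: PR norm_mult nk e2 del: norm_exp_eq_Re)
  moreover have "norm (exp (- k t) * (\<i> * m * P t)) \<le> m * exp (- 2 * \<alpha> * t) * norm (p t)" for t
    using m(1) by (simp add: PR norm_mult nk e2 del: norm_exp_eq_Re)
  ultimately have est: "norm (r x - r 0) \<le> (m + 3 * m\<^sup>2 * a) / (2 * \<alpha>)"
      "exp (- 2 * \<alpha> * x) * norm (p x - p 0) \<le> 3 * m / (2 * \<alpha>)"
    using init by (intro coupled_amplitudes_estimate[OF m contr G H _ _ _ _ x];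
      simp add: p_def r_def k0)+
  have "exp (- \<alpha> * x) *\<^sub>R R x - exp (\<i> * \<theta> x) * R 0 = exp (\<i> * \<theta> x) * (r x - r 0)"
    by (simp add: r_def \<theta>0 k_def scaleR_conv_of_real exp_add exp_diff exp_minus field_simps
      flip: exp_of_real)
  then show "norm (exp (- \<alpha> * x) *\<^sub>R R x - exp (\<i> * \<theta> x) * R 0) \<le> (m + 3 * m\<^sup>2 * a) / (2 * \<alpha>)"
    using est(1) by (simp add: norm_mult)
  have "exp (- \<alpha> * x) *\<^sub>R P x - of_real (exp (- 2 * \<alpha> * x)) * exp (- \<i> * \<theta> x) * P 0
      = of_real (exp (- 2 * \<alpha> * x)) * exp (- \<i> * \<theta> x) * (p x - p 0)"
  proof -
    have "exp (- \<alpha> * x) *\<^sub>R P x = (of_real (exp (- \<alpha> * x)) * exp (- k x)) * p x"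
      by (simp add: PR(1) scaleR_conv_of_real)
    also have "of_real (exp (- \<alpha> * x)) * exp (- k x) = of_real (exp (- 2 * \<alpha> * x)) * exp (- \<i> * \<theta> x)"
      by (simp add: k_def mult.assoc flip: exp_of_real exp_add)
    finally show ?thesis by (simp add: p_def k0 algebra_simps)
  qed
  then show "norm (exp (- \<alpha> * x) *\<^sub>R P x - of_real (exp (- 2 * \<alpha> * x)) * exp (- \<i> * \<theta> x) * P 0) \<le> 3 * m / (2 * \<alpha>)"
    using est(2) by (simp add: norm_mult)
qed

subsection \<open>The Dirac system\<close>

text \<open>Multiplying the system from the left by the eigenrows of \<open>sigma2\<close> turns
  each column of \<open>\<Phi>\<close> into a pair of modes as in
  \<open>dirac_mode_asymptotics\<close>. The two columns differ only in their initial values, hence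
  the arbitrary \<open>j\<close>.\<close>

lemma dirac_column_asymptotics:
  fixes \<Phi> :: "real \<Rightarrow> complex^2^2" and q :: "real \<Rightarrow> real" and j :: 2
  assumes sol: "dirac_matrix_solution a m q (\<mu> + \<i> * \<alpha>) \<Phi>"
    and m: "0 \<le> m" "0 < \<alpha>" "m \<le> \<alpha>" "m\<^sup>2 * a \<le> \<alpha>"
    and q: "q absolutely_integrable_on {0..a}"
    and x: "x \<in> {0..a}"
  defines "\<theta> \<equiv> integral {0..x} q - \<mu> * x"
  shows "norm (exp (- \<alpha> * x) *\<^sub>R (\<Phi> x $ 1 $ j + \<i> * \<Phi> x $ 2 $ j)
           - exp (\<i> * \<theta>) * (mat 1 $ 1 $ j + \<i> * mat 1 $ 2 $ j)) \<le> (m + 3 * m\<^sup>2 * a) / (2 * \<alpha>)"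
    and "norm (exp (- \<alpha> * x) *\<^sub>R (\<Phi> x $ 1 $ j - \<i> * \<Phi> x $ 2 $ j)
           - of_real (exp (- 2 * \<alpha> * x)) * exp (- \<i> * \<theta>) * (mat 1 $ 1 $ j - \<i> * mat 1 $ 2 $ j))
         \<le> 3 * m / (2 * \<alpha>)"
proof -
  have ac: "absolutely_continuous_on {0..a} (\<lambda>x. \<Phi> x $ i $ j)" for i
    using sol unfolding dirac_matrix_solution_def by blast
  have \<Phi>0: "\<Phi> 0 = mat 1"
    using sol unfolding dirac_matrix_solution_def by blast
  have "AE x in lebesgue. x \<in> {0..a} \<longrightarrow> (\<exists>\<Phi>'. (\<Phi> has_vector_derivative \<Phi>') (at x within {0..a}) \<and>
        (- \<i> *\<^sub>C sigma2) ** \<Phi>' + (m *\<^sub>R sigma3 + q x *\<^sub>R mat 1) ** \<Phi> x = (\<mu> + \<i> * \<alpha>) *\<^sub>C \<Phi> x)"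
    using sol unfolding dirac_matrix_solution_def by blast
  then obtain N where N: "N \<in> null_sets lebesgue" and
    "\<And>x. x \<in> space lebesgue - N \<Longrightarrow> x \<in> {0..a} \<longrightarrow> (\<exists>\<Phi>'. (\<Phi> has_vector_derivative \<Phi>') (at x within {0..a}) \<and>
        (- \<i> *\<^sub>C sigma2) ** \<Phi>' + (m *\<^sub>R sigma3 + q x *\<^sub>R mat 1) ** \<Phi> x = (\<mu> + \<i> * \<alpha>) *\<^sub>C \<Phi> x)"
    by (rule AE_E3) (rule that)
  then have "\<forall>x. \<exists>\<Phi>'. x \<in> {0..a} - N \<longrightarrow> (\<Phi> has_vector_derivative \<Phi>') (at x within {0..a}) \<and>
        (- \<i> *\<^sub>C sigma2) ** \<Phi>' + (m *\<^sub>R sigma3 + q x *\<^sub>R mat 1) ** \<Phi> x = (\<mu> + \<i> * \<alpha>) *\<^sub>C \<Phi> x"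
    by auto
  then obtain D where D: "\<And>x. x \<in> {0..a} - N \<Longrightarrow> (\<Phi> has_vector_derivative D x) (at x within {0..a})"
    "\<And>x. x \<in> {0..a} - N \<Longrightarrow>
      (- \<i> *\<^sub>C sigma2) ** D x + (m *\<^sub>R sigma3 + q x *\<^sub>R mat 1) ** \<Phi> x = (\<mu> + \<i> * \<alpha>) *\<^sub>C \<Phi> x"
    by metis
  have dc: "((\<lambda>x. \<Phi> x $ i $ j) has_vector_derivative D t $ i $ j) (at t within {0..a})"
    if "t \<in> {0..a} - N" for t i
    by (intro bounded_linear.has_vector_derivative[OF bounded_linear_vec_nth] D that)
  have eq: "(- \<i> *\<^sub>C sigma2 ** D t + (m *\<^sub>R sigma3 + q t *\<^sub>R mat 1) ** \<Phi> t) $ i $ j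
      = (\<mu> + \<i> * \<alpha>) * \<Phi> t $ i $ j" if "t \<in> {0..a} - N" for t i
    by (subst D(2)[OF that]) (simp add: cscale_def)
  \<comment> \<open>As \<open>- \<i> *\<^sub>C sigma2\<close> has rows \<open>(0, -1)\<close> and
    \<open>(1, 0)\<close>, the first row of the equation determines the derivative of the second
    component, and the second row that of the first.\<close>
  have d2: "D t $ 2 $ j = (m + q t - (\<mu> + \<i> * \<alpha>)) * \<Phi> t $ 1 $ j" if "t \<in> {0..a} - N" for t
    using eq[OF that, of 1]
    by (simp add: matrix_matrix_mult_def sum_2 cscale_def sigma2_def sigma3_def mat_def
        scaleR_conv_of_real[where 'a = complex] algebra_simps)
  have d1: "D t $ 1 $ j = (\<mu> + \<i> * \<alpha> - q t + m) * \<Phi> t $ 2 $ j" if "t \<in> {0..a} - N" for t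
    using eq[OF that, of 2]
    by (simp add: matrix_matrix_mult_def sum_2 cscale_def sigma2_def sigma3_def mat_def
        scaleR_conv_of_real[where 'a = complex] algebra_simps)
  have acR: "absolutely_continuous_on {0..a} (\<lambda>x. \<Phi> x $ 1 $ j + \<i> * \<Phi> x $ 2 $ j)"
    and acP: "absolutely_continuous_on {0..a} (\<lambda>x. \<Phi> x $ 1 $ j - \<i> * \<Phi> x $ 2 $ j)"
  proof -
    have *: "norm (u' + c * v' - (u + c * v)) \<le> 1 * norm (u' - u) + norm c * norm (v' - v)"
      for u u' v v' c :: complex
    proof -
      have "u' + c * v' - (u + c * v) = (u' - u) + c * (v' - v)" by (simp add: algebra_simps)
      then show ?thesis by (metis mult_1 norm_mult norm_triangle_ineq)
    qed
    show "absolutely_continuous_on {0..a} (\<lambda>x. \<Phi> x $ 1 $ j + \<i> * \<Phi> x $ 2 $ j)"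
      by (rule absolutely_continuous_on_dominated[OF ac ac *])
    show "absolutely_continuous_on {0..a} (\<lambda>x. \<Phi> x $ 1 $ j - \<i> * \<Phi> x $ 2 $ j)"
      using absolutely_continuous_on_dominated[OF ac ac *[where c = "- \<i>"]] by simp
  qed
  have dP: "((\<lambda>x. \<Phi> x $ 1 $ j - \<i> * \<Phi> x $ 2 $ j) has_vector_derivative
      - (\<alpha> + \<i> * (q t - \<mu>)) * (\<Phi> t $ 1 $ j - \<i> * \<Phi> t $ 2 $ j)
      + (- \<i> * m * (\<Phi> t $ 1 $ j + \<i> * \<Phi> t $ 2 $ j))) (at t within {0..a})"
    if t: "t \<in> {0..a} - N" for t
  proof -
    have *: "D t $ 1 $ j - \<i> * D t $ 2 $ j = - (\<alpha> + \<i> * (q t - \<mu>)) * (\<Phi> t $ 1 $ j - \<i> * \<Phi> t $ 2 $ j)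
      + (- \<i> * m * (\<Phi> t $ 1 $ j + \<i> * \<Phi> t $ 2 $ j))"
      by (simp add: d1[OF t] d2[OF t] algebra_simps)
    show ?thesis
      unfolding *[symmetric]
      by (intro has_vector_derivative_diff has_vector_derivative_mult_right dc t)
  qed
  have dR: "((\<lambda>x. \<Phi> x $ 1 $ j + \<i> * \<Phi> x $ 2 $ j) has_vector_derivative
      (\<alpha> + \<i> * (q t - \<mu>)) * (\<Phi> t $ 1 $ j + \<i> * \<Phi> t $ 2 $ j)
      + \<i> * m * (\<Phi> t $ 1 $ j - \<i> * \<Phi> t $ 2 $ j)) (at t within {0..a})"
    if t: "t \<in> {0..a} - N" for t
  proof -
    have *: "D t $ 1 $ j + \<i> * D t $ 2 $ j = (\<alpha> + \<i> * (q t - \<mu>)) * (\<Phi> t $ 1 $ j + \<i> * \<Phi> t $ 2 $ j)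
      + \<i> * m * (\<Phi> t $ 1 $ j - \<i> * \<Phi> t $ 2 $ j)"
      by (simp add: d1[OF t] d2[OF t] algebra_simps)
    show ?thesis
      unfolding *[symmetric]
      by (intro has_vector_derivative_add has_vector_derivative_mult_right dc t)
  qed
  have N': "negligible N" using N by (simp add: negligible_iff_null_sets)
  \<comment> \<open>For either column of the unit matrix exactly one entry is nonzero, so both
    initial values have modulus 1.\<close>
  have init: "norm (\<Phi> 0 $ 1 $ j - \<i> * \<Phi> 0 $ 2 $ j) \<le> 1" "norm (\<Phi> 0 $ 1 $ j + \<i> * \<Phi> 0 $ 2 $ j) \<le> 1"
    using exhaust_2[of j] by (auto simp: \<Phi>0 mat_def)
  note * = dirac_mode_asymptotics[OF m q acP acR N' dP dR init x]
  show "norm (exp (- \<alpha> * x) *\<^sub>R (\<Phi> x $ 1 $ j + \<i> * \<Phi> x $ 2 $ j)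
           - exp (\<i> * \<theta>) * (mat 1 $ 1 $ j + \<i> * mat 1 $ 2 $ j)) \<le> (m + 3 * m\<^sup>2 * a) / (2 * \<alpha>)"
    using *(1) unfolding \<theta>_def \<Phi>0 .
  show "norm (exp (- \<alpha> * x) *\<^sub>R (\<Phi> x $ 1 $ j - \<i> * \<Phi> x $ 2 $ j)
           - of_real (exp (- 2 * \<alpha> * x)) * exp (- \<i> * \<theta>) * (mat 1 $ 1 $ j - \<i> * mat 1 $ 2 $ j))
         \<le> 3 * m / (2 * \<alpha>)"
    using *(2) unfolding \<theta>_def \<Phi>0 .
qed

section \<open>From the two modes to the matrix norm\<close>

lemma norm_matrix_le:
  fixes A :: "complex^2^2"
  assumes "\<And>i j. norm (A $ i $ j) \<le> B"
  shows "norm A \<le> 4 * B"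
proof -
  have "norm (A $ i) \<le> 2 * B" for i :: 2
    using L2_set_le_sum[of UNIV "\<lambda>j. norm (A $ i $ j)"] assms[of i 1] assms[of i 2]
    by (simp add: norm_vec_def sum_2)
  from this[of 1] this[of 2] show ?thesis
    using L2_set_le_sum[of UNIV "\<lambda>i. norm (A $ i)"]
    unfolding norm_vec_def[of A] by (simp add: sum_2)
qed

theorem theorem7:
  fixes a m \<mu> :: real and q Q :: "real \<Rightarrow> real"
    and \<Phi> :: "real \<Rightarrow> complex \<Rightarrow> complex^2^2"
  assumes "a > 0"
    and "q absolutely_integrable_on {0..a}"
    and "m \<ge> 0"
    and "\<And>x. x \<in> {0..a} \<Longrightarrow> Q x = (LINT t:{0..x}|lebesgue. q t)"
    and "\<And>lam. dirac_matrix_solution a m q lam (\<lambda>x. \<Phi> x lam)"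
  shows "\<exists>C. \<forall>\<^sub>F \<alpha> in at_top. \<forall>x\<in>{0..a}.
    norm (exp (- \<alpha> * x) *\<^sub>R \<Phi> x (complex_of_real \<mu> + \<i> * complex_of_real \<alpha>)
      - (((1 / 2) * (exp (\<i> * complex_of_real (Q x - \<mu> * x))
             + complex_of_real (exp (- 2 * \<alpha> * x)) * exp (- \<i> * complex_of_real (Q x - \<mu> * x))))
           *\<^sub>C mat 1
         + ((1 / 2) * (- exp (\<i> * complex_of_real (Q x - \<mu> * x))
             + complex_of_real (exp (- 2 * \<alpha> * x)) * exp (- \<i> * complex_of_real (Q x - \<mu> * x))))
           *\<^sub>C sigma2))
    \<le> C / \<alpha>"
proof (intro exI[of _ "4 * m + 3 * m\<^sup>2 * a"] eventually_mono[OF eventually_ge_at_top] ballI)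
  fix \<alpha> x :: real
  \<comment> \<open>This threshold secures positivity of \<open>\<alpha>\<close> together with
    \<open>m \<le> \<alpha>\<close> and \<open>m\<^sup>2 * a \<le> \<alpha>\<close>. The constant
    \<open>4 * m + 3 * m\<^sup>2 * a\<close> adds the numerators
    \<open>m + 3 * m\<^sup>2 * a\<close> and \<open>3 * m\<close> of the two mode bounds: averaging
    them gives the denominator \<open>4 * \<alpha>\<close>, and the factor 4 from the number of
    entries cancels the 4.\<close>
  assume \<alpha>: "1 + m + m\<^sup>2 * a \<le> \<alpha>" and x: "x \<in> {0..a}"
  have "0 \<le> m\<^sup>2 * a" using assms(1) by simp
  then have m: "0 \<le> m" "0 < \<alpha>" "m \<le> \<alpha>" "m\<^sup>2 * a \<le> \<alpha>"
    using \<alpha> assms(3) by linarith+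
  define \<theta> where "\<theta> = Q x - \<mu> * x"
  define E where "E = exp (\<i> * complex_of_real \<theta>)"
  define F where "F = complex_of_real (exp (- 2 * \<alpha> * x)) * exp (- \<i> * complex_of_real \<theta>)"
  let ?\<Phi> = "\<Phi> x (complex_of_real \<mu> + \<i> * complex_of_real \<alpha>)"
  let ?T = "((1 / 2) * (E + F)) *\<^sub>C mat 1 + ((1 / 2) * (- E + F)) *\<^sub>C sigma2"
  have Q: "Q x = integral {0..x} q"
    using assms(4)[OF x] x
    by (simp add: set_lebesgue_integral_eq_integral(2)[OF absolutely_integrable_on_subinterval[OF assms(2)]])
  have "norm (exp (- \<alpha> * x) *\<^sub>R ?\<Phi> - ?T) \<le> 4 * ((4 * m + 3 * m\<^sup>2 * a) / (4 * \<alpha>))"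
  proof (rule norm_matrix_le)
    fix i j :: 2
    define R where "R = exp (- \<alpha> * x) *\<^sub>R (?\<Phi> $ 1 $ j + \<i> * ?\<Phi> $ 2 $ j) - E * (mat 1 $ 1 $ j + \<i> * mat 1 $ 2 $ j)"
    define P where "P = exp (- \<alpha> * x) *\<^sub>R (?\<Phi> $ 1 $ j - \<i> * ?\<Phi> $ 2 $ j) - F * (mat 1 $ 1 $ j - \<i> * mat 1 $ 2 $ j)"
    have RP: "norm R \<le> (m + 3 * m\<^sup>2 * a) / (2 * \<alpha>)" "norm P \<le> 3 * m / (2 * \<alpha>)"
      using dirac_column_asymptotics[OF assms(5) m assms(2) x, where j = j]
      unfolding R_def P_def E_def F_def \<theta>_def Q by blast+
    \<comment> \<open>The first component is half the sum of the two modes and the second is their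
      difference over \<open>2 * \<i>\<close>. The leading term obeys the same rule, because it is
      \<open>E\<close> times the projection \<open>(1 - sigma2) / 2\<close> plus \<open>F\<close>
      times \<open>(1 + sigma2) / 2\<close>, the spectral projections of \<open>sigma2\<close> for
      \<open>- 1\<close> and \<open>1\<close>.\<close>
    have 1: "(exp (- \<alpha> * x) *\<^sub>R ?\<Phi> - ?T) $ 1 $ j = (R + P) / 2"
      using exhaust_2[of j] unfolding R_def P_def
      by (auto simp: cscale_def mat_def sigma2_def scaleR_conv_of_real[where 'a = complex] field_simps)
    have 2: "(exp (- \<alpha> * x) *\<^sub>R ?\<Phi> - ?T) $ 2 $ j = (R - P) / (2 * \<i>)"
      using exhaust_2[of j] unfolding R_def P_def
      by (auto simp: cscale_def mat_def sigma2_def scaleR_conv_of_real[where 'a = complex] field_simps)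
    have le: "norm ((R + P) / 2) \<le> (norm R + norm P) / 2"
      "norm ((R - P) / (2 * \<i>)) \<le> (norm R + norm P) / 2"
      using norm_triangle_ineq[of R P] norm_triangle_ineq4[of R P] by (simp_all add: norm_divide norm_mult)
    have "norm ((exp (- \<alpha> * x) *\<^sub>R ?\<Phi> - ?T) $ i $ j) \<le> (norm R + norm P) / 2"
      using exhaust_2[of i] by (elim disjE) (simp_all only: 1 2 le)
    also have "\<dots> \<le> ((m + 3 * m\<^sup>2 * a) / (2 * \<alpha>) + 3 * m / (2 * \<alpha>)) / 2"
      using RP by (intro divide_right_mono add_mono) auto
    also have "\<dots> = (4 * m + 3 * m\<^sup>2 * a) / (4 * \<alpha>)"
      using m(2) by (simp add: field_simps)
    finally show "norm ((exp (- \<alpha> * x) *\<^sub>R ?\<Phi> - ?T) $ i $ j) \<le> \<dots>" .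
  qed
  also have "4 * ((4 * m + 3 * m\<^sup>2 * a) / (4 * \<alpha>)) = (4 * m + 3 * m\<^sup>2 * a) / \<alpha>"
    using m(2) by (simp add: field_simps)
  finally show "norm (exp (- \<alpha> * x) *\<^sub>R \<Phi> x (complex_of_real \<mu> + \<i> * complex_of_real \<alpha>)
      - (((1 / 2) * (exp (\<i> * complex_of_real (Q x - \<mu> * x))
             + complex_of_real (exp (- 2 * \<alpha> * x)) * exp (- \<i> * complex_of_real (Q x - \<mu> * x))))
           *\<^sub>C mat 1
         + ((1 / 2) * (- exp (\<i> * complex_of_real (Q x - \<mu> * x))
             + complex_of_real (exp (- 2 * \<alpha> * x)) * exp (- \<i> * complex_of_real (Q x - \<mu> * x))))
           *\<^sub>C sigma2))
    \<le> (4 * m + 3 * m\<^sup>2 * a) / \<alpha>"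
    unfolding E_def F_def \<theta>_def .
qed

end
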